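(* As formal power series in $x$ with coefficients in $\mathbb{Q}[s,t,u,v]$, $$P^{(\mathsf{pk},\mathsf{val},\mathsf{dasc},\mathsf{ddes})}(s,t,u,v;x)=\frac{t\,\frac{\partial}{\partial x}V\big(st,(u+v)/2;x\big)}{1-st\,V\big(st,(u+v)/2;x\big)}.$$
   Context: Let $\mathfrak{S}_n$ be the set of permutations $\pi=\pi_1\cdots\pi_n$ (one-line notation) of $[n]=\{1,\dots,n\}$. Use the convention $\pi_0=\pi_{n+1}=\infty$. A letter $\pi_i$ ($1\le i\le n$) of $\pi$ is a peak if $\pi_{i-1}<\pi_i>\pi_{i+1}$ (so necessarily $2\le i\le n-1$), a valley if $\pi_{i-1}>\pi_i<\pi_{i+1}$, a double ascent if $\pi_{i-1}<\pi_i<\pi_{i+1}$, and a double descent if $\pi_{i-1}>\pi_i>\pi_{i+1}$. Let $\mathsf{pk}(\pi),\mathsf{val}(\pi),\mathsf{dasc}(\pi),\mathsf{ddes}(\pi)$ be the numbers of peaks, valleys, double ascents and double descents of $\pi$, respectively. Define $$P^{(\mathsf{pk},\mathsf{val},\mathsf{dasc},\mathsf{ddes})}(s,t,u,v;x)=\sum_{n=1}^\infty\Big(\sum_{\pi\in\mathfrak{S}_n}s^{\mathsf{pk}(\pi)}t^{\mathsf{val}(\pi)}u^{\mathsf{dasc}(\pi)}v^{\mathsf{ddes}(\pi)}\Big)\frac{x^n}{n!}.$$ The bivariate Chebyshev polynomials of the second kind are defined by $U_0(s,t)=1$, $U_1(s,t)=2t$, and $U_n(s,t)=2tU_{n-1}(s,t)-sU_{n-2}(s,t)$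 for $n\ge2$. Define $V(s,t;x)=\sum_{n=0}^\infty U_n(s,t)\frac{x^{n+2}}{(n+2)!}$; $V(st,(u+v)/2;x)$ denotes the series obtained by substituting $st$ for the first argument $s$ and $(u+v)/2$ for the second argument $t$. *)

theory Defs
  imports
    "HOL-Library.Extended_Nat"
    "HOL-Library.Poly_Mapping"
    "HOL-Combinatorics.Permutations"
    "HOL-Computational_Algebra.Formal_Power_Series"
begin

section \<open>The polynomial ring in four indeterminates over the rationals\<close>

datatype indet = Ind_s | Ind_t | Ind_u | Ind_v

text \<open>A polynomial is a finitely supported map from monomials (exponent vectors) to coefficients;
  multiplication on this type is convolution.\<close>

type_synonym qpoly = "(indet \<Rightarrow>\<^sub>0 nat) \<Rightarrow>\<^sub>0 rat"

definition qconst :: "rat \<Rightarrow> qpoly" where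
  "qconst c = Poly_Mapping.single 0 c"

definition qvar :: "indet \<Rightarrow> qpoly" where
  "qvar y = Poly_Mapping.single (Poly_Mapping.single y 1) 1"


section \<open>Permutation statistics\<close>

text \<open>A permutation of \<open>{1..n}\<close> is a function \<open>\<pi>\<close> with \<open>\<pi> permutes {1..n}\<close>; its one-line notation is
  \<open>\<pi> 1, \<dots>, \<pi> n\<close>. All positions outside \<open>{1..n}\<close>, in particular \<open>0\<close> and \<open>n + 1\<close>, carry the letter
  \<open>\<infinity>\<close> (the value of the function itself there is irrelevant). As the letters are distinct, we count
  positions instead of letters.\<close>

definition letter :: "nat \<Rightarrow> (nat \<Rightarrow> nat) \<Rightarrow> nat \<Rightarrow> enat" where
  "letter n \<pi> i = (if i \<in> {1..n} then enat (\<pi> i) else \<infinity>)"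

definition pk :: "nat \<Rightarrow> (nat \<Rightarrow> nat) \<Rightarrow> nat" where
  "pk n \<pi> = card {i \<in> {1..n}. letter n \<pi> (i - 1) < letter n \<pi> i \<and> letter n \<pi> i > letter n \<pi> (i + 1)}"

definition valleys :: "nat \<Rightarrow> (nat \<Rightarrow> nat) \<Rightarrow> nat" where
  "valleys n \<pi> = card {i \<in> {1..n}. letter n \<pi> (i - 1) > letter n \<pi> i \<and> letter n \<pi> i < letter n \<pi> (i + 1)}"

definition dasc :: "nat \<Rightarrow> (nat \<Rightarrow> nat) \<Rightarrow> nat" where
  "dasc n \<pi> = card {i \<in> {1..n}. letter n \<pi> (i - 1) < letter n \<pi> i \<and> letter n \<pi> i < letter n \<pi> (i + 1)}"

definition ddes :: "nat \<Rightarrow> (nat \<Rightarrow> nat) \<Rightarrow> nat" where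
  "ddes n \<pi> = card {i \<in> {1..n}. letter n \<pi> (i - 1) > letter n \<pi> i \<and> letter n \<pi> i > letter n \<pi> (i + 1)}"

definition P_series :: "qpoly \<Rightarrow> qpoly \<Rightarrow> qpoly \<Rightarrow> qpoly \<Rightarrow> qpoly fps" where
  "P_series s t u v = Abs_fps (\<lambda>n. if n = 0 then 0 else
     (\<Sum>\<pi> | \<pi> permutes {1..n}. s ^ pk n \<pi> * t ^ valleys n \<pi> * u ^ dasc n \<pi> * v ^ ddes n \<pi>)
       * qconst (1 / fact n))"


section \<open>Bivariate Chebyshev polynomials of the second kind\<close>

fun cheb_U :: "nat \<Rightarrow> 'a::comm_ring_1 \<Rightarrow> 'a \<Rightarrow> 'a" where
  "cheb_U 0 s t = 1"
| "cheb_U (Suc 0) s t = 2 * t"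
| "cheb_U (Suc (Suc n)) s t = 2 * t * cheb_U (Suc n) s t - s * cheb_U n s t"

text \<open>The coefficient of \<open>x ^ m\<close> with \<open>m = n + 2\<close> is \<open>U\<^sub>n(s,t) / m!\<close>.\<close>

definition V_series :: "qpoly \<Rightarrow> qpoly \<Rightarrow> qpoly fps" where
  "V_series s t = Abs_fps (\<lambda>m. if m < 2 then 0 else cheb_U (m - 2) s t * qconst (1 / fact m))"


section \<open>Quotients of power series\<close>

text \<open>The library division on power series requires an inverse operation on the coefficients, which a
  polynomial ring lacks. We only divide by series with constant coefficient \<open>1\<close>; these are units
  over every commutative ring.\<close>

definition fps_quot :: "'a::comm_ring_1 fps \<Rightarrow> 'a fps \<Rightarrow> 'a fps" where
  "fps_quot f g = f * fps_right_inverse g 1"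

lemma fps_quot_mult:
  assumes "fps_nth g 0 = 1"
  shows "fps_quot f g * g = f"
proof -
  have "g * fps_right_inverse g 1 = 1"
    using assms by (intro fps_right_inverse) simp
  then show ?thesis
    by (simp add: fps_quot_def mult.assoc mult.commute[of g])
qed

lemma denominator_nth_0: "fps_nth (1 - fps_const c * V_series a b) 0 = 1"
  by (simp add: V_series_def)

end

theory Submission
  imports Defs "HOL-Combinatorics.Multiset_Permutations"
begin

text \<open>Splitting a permutation at its largest letter gives the Riccati equation
  \<open>P' = t + (u + v) P + s P\<^sup>2\<close>, because the largest letter plays the role of \<open>\<infinity>\<close> for the words to
  its left and right. The Chebyshev recurrence says \<open>V'' = 1 + (u + v) V' - s t V\<close>. Consequently
  \<open>G = (1 - s t V) P - t V'\<close> satisfies \<open>G' = (u + v + s P) G\<close> with \<open>G(0) = 0\<close>, so \<open>G = 0\<close>.\<close>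


unbundle fps_syntax


section \<open>Weighted words\<close>

text \<open>Only strict comparisons enter, so a letter equal to one of its neighbours may get weight \<open>1\<close>.\<close>

definition letter_weight ::
    "'a \<Rightarrow> 'a \<Rightarrow> 'a \<Rightarrow> 'a \<Rightarrow> 'b::linorder \<Rightarrow> 'b \<Rightarrow> 'b \<Rightarrow> 'a::comm_semiring_1" where
  "letter_weight s t u v a b c =
     (if a < b \<and> b > c then s else 1) * (if a > b \<and> b < c then t else 1) *
     (if a < b \<and> b < c then u else 1) * (if a > b \<and> b > c then v else 1)"

fun word_weight :: "('b \<Rightarrow> 'b \<Rightarrow> 'b \<Rightarrow> 'a::comm_semiring_1) \<Rightarrow> 'b \<Rightarrow> 'b list \<Rightarrow> 'b \<Rightarrow> 'a" where
  "word_weight w l [] r = 1"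
| "word_weight w l (x # xs) r = w l x (hd (xs @ [r])) * word_weight w x xs r"

text \<open>A letter's weight depends only on its two neighbours, so \<open>m\<close> separates the
  two sides: it is the right boundary of \<open>xs\<close> and the left boundary of
  \<open>ys\<close>.\<close>

lemma word_weight_append_Cons:
  "word_weight w l (xs @ m # ys) r =
     word_weight w l xs m * w (last (l # xs)) m (hd (ys @ [r])) * word_weight w m ys r"
proof (induction xs arbitrary: l)
  case (Cons x xs)
  have "hd ((xs @ m # ys) @ [r]) = hd (xs @ [m])"
    by (cases xs) auto
  with Cons show ?case
    by (simp add: mult.assoc)
qed simp

text \<open>Bridge from the recursive weight to products over positions. The start \<open>k\<close>
  is free because removing the first letter shifts the window.\<close>

lemma word_weight_map_upt:
  "word_weight w (f k) (map f [Suc k..<Suc k + n]) (f (Suc k + n)) =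
     (\<Prod>i = Suc k..<Suc k + n. w (f (i - 1)) (f i) (f (i + 1)))"
proof (induction n arbitrary: k)
  case (Suc n)
  have upt: "[Suc k..<Suc k + Suc n] = Suc k # [Suc (Suc k)..<Suc (Suc k) + n]"
    by (simp add: upt_rec)
  have ivl: "{Suc k..<Suc k + Suc n} = insert (Suc k) {Suc (Suc k)..<Suc (Suc k) + n}"
    by auto
  have hd: "hd (map f [Suc (Suc k)..<Suc (Suc k) + n] @ [f (Suc k + Suc n)]) = f (Suc (Suc k))"
    by (cases n) (auto simp: upt_rec)
  show ?case
    unfolding upt ivl list.map word_weight.simps hd using Suc[of "Suc k"] by simp
qed simp


section \<open>Splitting permutations at the largest letter\<close>

lemma takeWhile_neq_append_Cons:
  "m \<notin> set ys \<Longrightarrow> takeWhile (\<lambda>x. x \<noteq> m) (ys @ m # zs) = ys"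
  by (induction ys) auto

lemma dropWhile_neq_append_Cons:
  "m \<notin> set ys \<Longrightarrow> dropWhile (\<lambda>x. x \<noteq> m) (ys @ m # zs) = m # zs"
  by (induction ys) auto

text \<open>Since \<open>m\<close> occurs exactly once in each word, cutting there is reversible;
  \<open>A\<close> is recovered as the set of letters before \<open>m\<close>.\<close>

lemma sum_permutations_of_set_insert:
  assumes "finite T" "m \<notin> T"
  shows "(\<Sum>xs\<in>permutations_of_set (insert m T). f xs) =
    (\<Sum>A\<in>Pow T. \<Sum>ys\<in>permutations_of_set A. \<Sum>zs\<in>permutations_of_set (T - A). f (ys @ m # zs))"
proof -
  have "(\<Sum>A\<in>Pow T. \<Sum>ys\<in>permutations_of_set A. \<Sum>zs\<in>permutations_of_set (T - A). f (ys @ m # zs)) =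
    (\<Sum>A\<in>Pow T. \<Sum>(ys, zs)\<in>permutations_of_set A \<times> permutations_of_set (T - A). f (ys @ m # zs))"
    by (simp add: sum.cartesian_product)
  also have "\<dots> = (\<Sum>(A, ys, zs)\<in>(SIGMA A:Pow T. permutations_of_set A \<times> permutations_of_set (T - A)).
      f (ys @ m # zs))"
    using assms(1) by (subst sum.Sigma) auto
  also have "\<dots> = (\<Sum>xs\<in>permutations_of_set (insert m T). f xs)"
  proof (rule sum.reindex_bij_witness[where j = "\<lambda>(A, ys, zs). ys @ m # zs" and
      i = "\<lambda>xs. (set (takeWhile (\<lambda>x. x \<noteq> m) xs), takeWhile (\<lambda>x. x \<noteq> m) xs, tl (dropWhile (\<lambda>x. x \<noteq> m) xs))"],
      goal_cases)
    case (1 a)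
    then obtain A ys zs where a: "a = (A, ys, zs)" "A \<subseteq> T" "set ys = A"
      by (auto simp: permutations_of_set_def)
    with assms have "m \<notin> set ys" by auto
    with a show ?case by (simp add: takeWhile_neq_append_Cons dropWhile_neq_append_Cons)
  next
    case (2 a)
    then show ?case using assms by (auto simp: permutations_of_set_def)
  next
    case (3 xs)
    then have "m \<in> set xs" by (auto simp: permutations_of_set_def)
    then obtain ys zs where "xs = ys @ m # zs" "m \<notin> set ys"
      by (meson split_list_first)
    then show ?case by (simp add: takeWhile_neq_append_Cons dropWhile_neq_append_Cons)
  next
    case (4 xs)
    then have "m \<in> set xs" by (auto simp: permutations_of_set_def)
    then obtain ys zs where xs: "xs = ys @ m # zs" "m \<notin> set ys"
      by (meson split_list_first)
    then have "takeWhile (\<lambda>x. x \<noteq> m) xs = ys" "dropWhile (\<lambda>x. x \<noteq> m) xs = m # zs"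
      by (simp_all add: takeWhile_neq_append_Cons dropWhile_neq_append_Cons)
    with 4 xs assms show ?case by (auto simp: permutations_of_set_def)
  qed auto
  finally show ?thesis ..
qed

text \<open>Subsets are grouped by size; this is the source of the binomial coefficients in
  \<open>perm_poly\<close>.\<close>

lemma sum_Pow_card:
  fixes g :: "nat \<Rightarrow> 'a::comm_semiring_1"
  assumes "finite T"
  shows "(\<Sum>A\<in>Pow T. g (card A)) = (\<Sum>j\<le>card T. of_nat (card T choose j) * g j)"
proof -
  have "(\<Sum>A\<in>Pow T. g (card A)) = (\<Sum>j\<le>card T. \<Sum>A\<in>{A \<in> Pow T. card A = j}. g (card A))"
    using assms by (intro sum.group[symmetric]) (auto intro: card_mono)
  also have "\<dots> = (\<Sum>j\<le>card T. of_nat (card T choose j) * g j)"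
    using n_subsets[OF assms] by (intro sum.cong) auto
  finally show ?thesis .
qed

text \<open>The weight of the largest letter, with \<open>i\<close> letters to its left and \<open>j\<close> to its right.\<close>

definition max_weight :: "'a \<Rightarrow> 'a \<Rightarrow> 'a \<Rightarrow> 'a \<Rightarrow> nat \<Rightarrow> nat \<Rightarrow> 'a" where
  "max_weight s t u v i j =
     (if i = 0 then if j = 0 then t else v else if j = 0 then u else s)"

text \<open>Here \<open>j\<close> counts the letters left of the largest one, and the binomial
  coefficient chooses which they are. The value 1 at 0 belongs to the empty word.\<close>

fun perm_poly :: "'a \<Rightarrow> 'a \<Rightarrow> 'a \<Rightarrow> 'a \<Rightarrow> nat \<Rightarrow> 'a::comm_semiring_1" where
  "perm_poly s t u v 0 = 1"
| "perm_poly s t u v (Suc n) =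
     (\<Sum>j\<le>n. of_nat (n choose j) *
       (max_weight s t u v j (n - j) * perm_poly s t u v j * perm_poly s t u v (n - j)))"

text \<open>The boundary letters are arbitrary so that the induction can replace them by the maximum.\<close>

lemma sum_word_weight:
  fixes S :: "'b::linorder set"
  assumes "finite S" "\<And>x. x \<in> S \<Longrightarrow> x < l" "\<And>x. x \<in> S \<Longrightarrow> x < r"
  shows "(\<Sum>xs\<in>permutations_of_set S. word_weight (letter_weight s t u v) l xs r) =
    perm_poly s t u v (card S)"
  using assms
proof (induction "card S" arbitrary: S l r rule: less_induct)
  case less
  show ?case
  proof (cases "S = {}")
    case False
    define m where "m = Max S"
    define T where "T = S - {m}"
    let ?w = "letter_weight s t u v"
    let ?k = "max_weight s t u v"
    let ?c = "perm_poly s t u v"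
    have m: "m \<in> S" using False less.prems(1) by (simp add: m_def)
    have S: "S = insert m T" "m \<notin> T" using m by (auto simp: T_def)
    have fin: "finite T" using less.prems(1) by (simp add: T_def)
    have Tm: "x < m" if "x \<in> T" for x
      using that less.prems(1) Max_ge[of S x] by (auto simp: T_def m_def order.strict_iff_order)
    have card: "card S = Suc (card T)" using S fin by simp
    have ml: "m < l" and mr: "m < r" using less.prems m by auto
    \<comment> \<open>\<open>m\<close> exceeds every letter of \<open>T\<close> but lies below
      \<open>l\<close> and \<open>r\<close>, so its neighbour on a side is smaller exactly when that
      side is nonempty.\<close>
    have middle: "?w (last (l # ys)) m (hd (zs @ [r])) = ?k (card A) (card T - card A)"
      if "A \<in> Pow T" "ys \<in> permutations_of_set A" "zs \<in> permutations_of_set (T - A)" for A ys zs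
    proof -
      have sets: "set ys = A" "set zs = T - A" "finite A"
        using that fin by (auto simp: permutations_of_set_def intro: finite_subset)
      have "card T - card A = card (T - A)" using sets that by (simp add: card_Diff_subset)
      then have cz: "card T - card A = 0 \<longleftrightarrow> zs = []" using sets fin by (metis card_0_eq finite_Diff set_empty)
      have cy: "card A = 0 \<longleftrightarrow> ys = []" using sets by auto
      have ly: "last (l # ys) < m" if "ys \<noteq> []"
        using that Tm[of "last ys"] sets \<open>A \<in> Pow T\<close> last_in_set[of ys] by auto
      have hz: "hd (zs @ [r]) < m" if "zs \<noteq> []"
        using that Tm[of "hd zs"] sets hd_in_set[of zs] by auto
      show ?thesis
        using ly hz ml mr unfolding max_weight_def cz cy letter_weight_def
        by (cases "ys = []"; cases "zs = []") (auto dest: order.asym)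
    qed
    \<comment> \<open>A subset of \<open>T\<close> has fewer letters than \<open>S\<close>. The
      boundaries only have to exceed \<open>T\<close>, so \<open>m\<close> qualifies as well as
      \<open>l\<close> and \<open>r\<close>.\<close>
    have IH: "(\<Sum>xs\<in>permutations_of_set B. word_weight ?w l' xs r') = ?c (card B)"
      if "B \<subseteq> T" "\<And>x. x \<in> T \<Longrightarrow> x < l'" "\<And>x. x \<in> T \<Longrightarrow> x < r'" for B l' r'
      using that fin card card_mono[OF fin that(1)] by (intro less.hyps) (auto intro: finite_subset)
    have Tl: "x < l" "x < r" if "x \<in> T" for x using less.prems that S by auto
    have "(\<Sum>xs\<in>permutations_of_set S. word_weight ?w l xs r) =
      (\<Sum>A\<in>Pow T. \<Sum>ys\<in>permutations_of_set A. \<Sum>zs\<in>permutations_of_set (T - A).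
        ?k (card A) (card T - card A) * (word_weight ?w l ys m * word_weight ?w m zs r))"
      unfolding S(1) sum_permutations_of_set_insert[OF fin S(2)] word_weight_append_Cons
      by (intro sum.cong refl) (simp only: middle mult_ac)
    also have "\<dots> = (\<Sum>A\<in>Pow T. ?k (card A) (card T - card A) *
        ((\<Sum>ys\<in>permutations_of_set A. word_weight ?w l ys m) *
         (\<Sum>zs\<in>permutations_of_set (T - A). word_weight ?w m zs r)))"
      by (simp only: sum_product) (simp only: sum_distrib_left)
    also have "\<dots> = (\<Sum>A\<in>Pow T. ?k (card A) (card T - card A) * (?c (card A) * ?c (card T - card A)))"
    proof (intro sum.cong refl)
      fix A assume A: "A \<in> Pow T"
      then have "card (T - A) = card T - card A"
        using fin by (intro card_Diff_subset) (auto intro: finite_subset)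
      then show "?k (card A) (card T - card A) *
          ((\<Sum>ys\<in>permutations_of_set A. word_weight ?w l ys m) *
           (\<Sum>zs\<in>permutations_of_set (T - A). word_weight ?w m zs r)) =
          ?k (card A) (card T - card A) * (?c (card A) * ?c (card T - card A))"
        using A IH[of A l m] IH[of "T - A" m r] Tm Tl by simp
    qed
    also have "\<dots> = ?c (card S)"
      unfolding card using sum_Pow_card[OF fin, of "\<lambda>j. ?k j (card T - j) * (?c j * ?c (card T - j))"]
      by (simp add: mult.assoc)
    finally show ?thesis .
  qed simp
qed


section \<open>Permutations as words\<close>

lemma bij_betw_permutes_words:
  "bij_betw (\<lambda>\<pi>. map \<pi> [1..<Suc n]) {\<pi>. \<pi> permutes {1..n}} (permutations_of_set {1..n})"
proof -
  have inj: "inj_on (\<lambda>\<pi>. map \<pi> [1..<Suc n]) {\<pi>. \<pi> permutes {1..n}}"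
  proof (rule inj_onI)
    fix \<pi> \<rho> :: "nat \<Rightarrow> nat"
    assume p: "\<pi> \<in> {\<pi>. \<pi> permutes {1..n}}" "\<rho> \<in> {\<pi>. \<pi> permutes {1..n}}"
      and eq: "map \<pi> [1..<Suc n] = map \<rho> [1..<Suc n]"
    have "\<pi> i = \<rho> i" if "i \<in> {1..n}" for i
      using eq that unfolding map_eq_conv set_upt by auto
    moreover have "\<pi> i = \<rho> i" if "i \<notin> {1..n}" for i
      using p that by (metis mem_Collect_eq permutes_not_in)
    ultimately show "\<pi> = \<rho>" by blast
  qed
  have sub: "(\<lambda>\<pi>. map \<pi> [1..<Suc n]) ` {\<pi>. \<pi> permutes {1..n}} \<subseteq> permutations_of_set {1..n}"
  proof safe
    fix \<pi> assume p: "\<pi> permutes {1..n}"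
    have "{1..<Suc n} = {1..n}" by auto
    then show "map \<pi> [1..<Suc n] \<in> permutations_of_set {1..n}"
      using permutes_image[OF p] permutes_inj_on[OF p, of "{1..n}"]
      by (auto simp: permutations_of_set_def distinct_map simp del: upt_Suc)
  qed
  \<comment> \<open>Both sets have n! elements, so surjectivity follows from injectivity and
    inclusion.\<close>
  have "card ((\<lambda>\<pi>. map \<pi> [1..<Suc n]) ` {\<pi>. \<pi> permutes {1..n}}) = card (permutations_of_set {1..n})"
    using card_image[OF inj] card_permutations[of "{1..n}" n] by simp
  with inj sub show ?thesis
    unfolding bij_betw_def by (simp add: card_subset_eq)
qed

text \<open>Each power is a product over positions with factor 1 where the pattern is absent; the
  four products merge into one product of \<open>letter_weight\<close>.\<close>

lemma perm_weight_eq_word_weight: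
  "s ^ pk n \<pi> * t ^ valleys n \<pi> * u ^ dasc n \<pi> * v ^ ddes n \<pi> =
     word_weight (letter_weight s t u v) \<infinity> (map enat (map \<pi> [1..<Suc n])) \<infinity>"
proof -
  have power: "a ^ card {i \<in> {1..n}. Q i} = (\<Prod>i = 1..n. if Q i then a else 1)"
    for a :: 'a and Q
    by (simp add: prod.If_cases Int_def)
  have "map enat (map \<pi> [1..<Suc n]) = map (letter n \<pi>) [Suc 0..<Suc 0 + n]"
    by (auto simp: letter_def)
  moreover have "letter n \<pi> 0 = \<infinity>" "letter n \<pi> (Suc 0 + n) = \<infinity>"
    by (auto simp: letter_def)
  moreover have "{Suc 0..<Suc 0 + n} = {1..n}" by auto
  ultimately show ?thesis
    using word_weight_map_upt[of "letter_weight s t u v" "letter n \<pi>" 0 n]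
    unfolding pk_def valleys_def dasc_def ddes_def power
    by (simp only: letter_weight_def prod.distrib)
qed

text \<open>\<open>sum_word_weight\<close> is applied to the letters embedded in
  \<open>enat\<close>, where \<infinity> lies above all of them and serves as both
  boundaries.\<close>

lemma sum_perm_weight:
  "(\<Sum>\<pi> | \<pi> permutes {1..n}. s ^ pk n \<pi> * t ^ valleys n \<pi> * u ^ dasc n \<pi> * v ^ ddes n \<pi>) =
     perm_poly s t u v n"
proof -
  let ?W = "\<lambda>xs. word_weight (letter_weight s t u v) \<infinity> xs \<infinity>"
  have inj: "inj_on enat {1..n}" by (auto intro: inj_onI)
  have "(\<Sum>\<pi> | \<pi> permutes {1..n}. s ^ pk n \<pi> * t ^ valleys n \<pi> * u ^ dasc n \<pi> * v ^ ddes n \<pi>) =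
      (\<Sum>xs\<in>permutations_of_set {1..n}. ?W (map enat xs))"
    unfolding perm_weight_eq_word_weight
    by (rule sum.reindex_bij_betw[OF bij_betw_permutes_words])
  also have "\<dots> = (\<Sum>xs\<in>permutations_of_set (enat ` {1..n}). ?W xs)"
    by (subst permutations_of_set_image_inj[OF inj], subst sum.reindex)
      (auto intro: inj_onI simp: inj_def)
  also have "\<dots> = perm_poly s t u v (card (enat ` {1..n}))"
    by (rule sum_word_weight) auto
  finally show ?thesis unfolding card_image[OF inj] by simp
qed


section \<open>The differential equations\<close>

lemma qconst_1: "qconst 1 = 1"
  by (simp add: qconst_def)

lemma qconst_mult: "qconst (a * b) = qconst a * qconst b"
  by (simp add: qconst_def mult_single)

lemma qconst_of_nat: "qconst (of_nat n) = of_nat n"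
  by (simp add: qconst_def)

lemma of_nat_mult_qconst: "of_nat n * qconst a = qconst (of_nat n * a)"
  by (simp add: qconst_mult qconst_of_nat)

text \<open>For exponential generating functions differentiation is an index shift: the factor n + 1
  turns 1/(n+1)! into 1/n!.\<close>

lemma fps_deriv_qconst_fact:
  "fps_deriv (Abs_fps (\<lambda>n. c n * qconst (1 / fact n))) = Abs_fps (\<lambda>n. c (Suc n) * qconst (1 / fact n))"
proof (rule fps_ext)
  fix n
  have "of_nat (Suc n) * (1 / fact (Suc n)) = (1 / fact n :: rat)"
    by (simp add: field_simps del: of_nat_Suc)
  then have "of_nat (Suc n) * qconst (1 / fact (Suc n)) = qconst (1 / fact n)"
    by (simp only: of_nat_mult_qconst)
  then show "fps_deriv (Abs_fps (\<lambda>n. c n * qconst (1 / fact n))) $ n =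
      Abs_fps (\<lambda>n. c (Suc n) * qconst (1 / fact n)) $ n"
    by (simp add: mult.left_commute[of _ "c _"] del: of_nat_Suc fact_Suc)
qed

text \<open>The equation expresses k + 1 times coefficient k + 1 of \<open>G\<close> through
  coefficients 0 to k, which vanish by induction.\<close>

lemma fps_linear_ode_unique:
  fixes G H :: "qpoly fps"
  assumes "fps_deriv G = H * G" "G $ 0 = 0"
  shows "G = 0"
proof -
  have "G $ n = 0" for n
  proof (induction n rule: less_induct)
    case (less n)
    show ?case
    proof (cases n)
      case (Suc k)
      have "of_nat (Suc k) * G $ Suc k = (H * G) $ k"
        using assms(1) by (metis fps_deriv_nth Suc_eq_plus1)
      also have "\<dots> = 0"
        unfolding fps_mult_nth using less.IH Suc by (intro sum.neutral) auto
      \<comment> \<open>The polynomial ring has no division, but it contains the rational constants,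
        so k + 1 is a unit.\<close>
      finally have "qconst (1 / of_nat (Suc k)) * of_nat (Suc k) * G $ Suc k = 0"
        by (simp only: mult.assoc mult_zero_right)
      moreover have "qconst (1 / of_nat (Suc k)) * of_nat (Suc k) = 1"
        by (simp add: mult.commute of_nat_mult_qconst qconst_1 del: of_nat_Suc)
      ultimately show ?thesis using Suc by simp
    qed (simp add: assms(2))
  qed
  then show ?thesis by (simp add: fps_ext)
qed

lemma P_series_nth_0: "P_series s t u v $ 0 = 0"
  by (simp add: P_series_def)

lemma P_series_nth: "n > 0 \<Longrightarrow> P_series s t u v $ n = perm_poly s t u v n * qconst (1 / fact n)"
  by (simp add: P_series_def sum_perm_weight del: One_nat_def)

text \<open>Dividing by factorials turns the binomial convolution in \<open>perm_poly\<close> into a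
  Cauchy product, whose terms are then sorted by the value of \<open>max_weight\<close>.\<close>

lemma P_series_deriv:
  fixes s t u v :: qpoly
  defines "P \<equiv> P_series s t u v"
  shows "fps_deriv P = fps_const t + fps_const (u + v) * P + fps_const s * P\<^sup>2"
proof (rule fps_ext)
  fix n
  let ?k = "max_weight s t u v"
  \<comment> \<open>\<open>e\<close> keeps the coefficient 1 of the empty word, which
    \<open>P\<close> omits; the derivative is the same for both.\<close>
  define e where "e j = perm_poly s t u v j * qconst (1 / fact j)" for j
  have e0: "e 0 = 1" by (simp add: e_def qconst_1)
  have P: "P $ j = (if j = 0 then 0 else e j)" for j
    by (simp add: P_def P_series_nth_0 P_series_nth e_def)
  have "fps_deriv P = fps_deriv (Abs_fps e)"
    by (rule fps_ext) (simp add: P)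
  also have "Abs_fps e = Abs_fps (\<lambda>j. perm_poly s t u v j * qconst (1 / fact j))"
    by (simp add: e_def[abs_def])
  finally have "fps_deriv P $ n = perm_poly s t u v (Suc n) * qconst (1 / fact n)"
    by (simp only: fps_deriv_qconst_fact fps_nth_Abs_fps)
  also have "\<dots> = (\<Sum>j\<le>n. ?k j (n - j) * e j * e (n - j))"
    unfolding perm_poly.simps sum_distrib_right
  proof (intro sum.cong refl)
    fix j assume "j \<in> {..n}"
    then have "of_nat (n choose j) * (1 / fact n) = (1 / fact j * (1 / fact (n - j)) :: rat)"
      by (simp add: binomial_fact)
    then have q: "of_nat (n choose j) * qconst (1 / fact n) = qconst (1 / fact j) * qconst (1 / fact (n - j))"
      by (simp only: of_nat_mult_qconst qconst_mult)
    have "of_nat (n choose j) * (?k j (n - j) * perm_poly s t u v j * perm_poly s t u v (n - j)) *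
        qconst (1 / fact n) = ?k j (n - j) * perm_poly s t u v j * perm_poly s t u v (n - j) *
        (of_nat (n choose j) * qconst (1 / fact n))"
      by (simp only: mult_ac)
    also have "\<dots> = ?k j (n - j) * e j * e (n - j)"
      unfolding q e_def by (simp only: mult_ac)
    finally show "of_nat (n choose j) * (?k j (n - j) * perm_poly s t u v j * perm_poly s t u v (n - j)) *
        qconst (1 / fact n) = ?k j (n - j) * e j * e (n - j)" .
  qed
  also have "\<dots> = (fps_const t + fps_const (u + v) * P + fps_const s * P\<^sup>2) $ n"
  proof (cases "n = 0")
    case True
    then show ?thesis by (simp add: e0 P max_weight_def power2_eq_square)
  next
    case False
    \<comment> \<open>For positive \<open>n\<close> the two end terms are distinct:
      \<open>j = 0\<close> contributes \<open>v\<close> and \<open>j = n\<close> contributes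
      \<open>u\<close>.\<close>
    have "{..n} = insert 0 (insert n {1..<n})" using False by auto
    then have "(\<Sum>j\<le>n. ?k j (n - j) * e j * e (n - j)) =
        (u + v) * e n + (\<Sum>j = 1..<n. ?k j (n - j) * e j * e (n - j))"
      using False by (simp add: max_weight_def e0 algebra_simps)
    also have "(\<Sum>j = 1..<n. ?k j (n - j) * e j * e (n - j)) = (\<Sum>j = 1..<n. s * (P $ j * P $ (n - j)))"
      by (intro sum.cong) (auto simp: max_weight_def P mult.assoc)
    \<comment> \<open>The ends can be added back because each contains the factor
      \<open>P $ 0\<close>, which is 0.\<close>
    also have "\<dots> = (\<Sum>j = 0..n. s * (P $ j * P $ (n - j)))"
      by (intro sum.mono_neutral_left) (auto simp: P)
    also have "\<dots> = s * P\<^sup>2 $ n"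
      by (simp add: power2_eq_square fps_mult_nth sum_distrib_left)
    finally show ?thesis using False by (simp add: P)
  qed
  finally show "fps_deriv P $ n = (fps_const t + fps_const (u + v) * P + fps_const s * P\<^sup>2) $ n" .
qed

lemma V_series_deriv2:
  "fps_deriv (fps_deriv (V_series a b)) =
     1 + fps_const (2 * b) * fps_deriv (V_series a b) - fps_const a * V_series a b"
proof -
  define c where "c m = (if m < 2 then 0 else cheb_U (m - 2) a b)" for m
  have V: "V_series a b = Abs_fps (\<lambda>m. c m * qconst (1 / fact m))"
    by (auto simp: V_series_def c_def intro!: fps_ext)
  \<comment> \<open>Padding by \<open>c 0 = c 1 = 0\<close> absorbs both initial values of the
    Chebyshev recurrence; only \<open>n = 0\<close> needs an extra 1, which becomes the constant
    term of the equation.\<close>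
  have c: "c (Suc (Suc n)) = (if n = 0 then 1 else 0) + 2 * b * c (Suc n) - a * c n" for n
  proof (cases n)
    case (Suc k)
    then show ?thesis by (cases k) (auto simp: c_def numeral_2_eq_2)
  qed (simp add: c_def)
  show ?thesis
    unfolding V fps_deriv_qconst_fact
    by (rule fps_ext) (auto simp: c algebra_simps qconst_1)
qed

lemma P_series_mult_denominator:
  fixes s t u v :: qpoly
  defines "V \<equiv> V_series (s * t) ((u + v) * qconst (1 / 2))"
  shows "P_series s t u v * (1 - fps_const (s * t) * V) = fps_const t * fps_deriv V"
proof -
  define P where "P = P_series s t u v"
  define D where "D = 1 - fps_const (s * t) * V"
  define G where "G = P * D - fps_const t * fps_deriv V"
  \<comment> \<open>The 2 of the Chebyshev recurrence cancels the half in the second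
    argument.\<close>
  have "2 * qconst (1 / 2) = 1"
    using of_nat_mult_qconst[of 2 "1 / 2"] by (simp add: qconst_1)
  then have "2 * ((u + v) * qconst (1 / 2)) = u + v"
    by (simp only: mult.left_commute[of 2] mult_1_right)
  then have V2: "fps_deriv (fps_deriv V) = fps_const (u + v) * fps_deriv V + D"
    unfolding V_def D_def V_series_deriv2 by simp
  have P1: "fps_deriv P = fps_const t + fps_const (u + v) * P + fps_const s * P\<^sup>2"
    unfolding P_def by (rule P_series_deriv)
  have D1: "fps_deriv D = - (fps_const s * fps_const t * fps_deriv V)"
    by (simp add: D_def)
  have "fps_deriv G = fps_deriv P * D + P * fps_deriv D - fps_const t * fps_deriv (fps_deriv V)"
    by (simp add: G_def)
  \<comment> \<open>The terms \<open>t * D\<close> coming from P' and from V'' cancel; what remains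
    has \<open>G\<close> as a factor.\<close>
  also have "\<dots> = (fps_const (u + v) + fps_const s * P) * G"
    unfolding G_def P1 D1 V2 by (simp add: algebra_simps power2_eq_square flip: fps_const_mult)
  \<comment> \<open>\<open>G\<close> has constant coefficient 0 because \<open>P\<close> has, and
    because \<open>V\<close> starts at x^2.\<close>
  finally have "G = 0"
    by (rule fps_linear_ode_unique) (simp add: G_def P_def P_series_nth_0 V_def V_series_def)
  then show ?thesis by (simp add: G_def P_def D_def)
qed

text \<open>A series with constant coefficient 1 is a unit, so an identity for the quotient reduces
  to the multiplied-out one.\<close>

lemma fps_quot_eqI:
  assumes "fps_nth g 0 = 1" "h * g = f"
  shows "fps_quot f g = h"
proof -
  have "g * fps_right_inverse g 1 = 1"
    using assms(1) by (intro fps_right_inverse) simp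
  then show ?thesis
    using assms(2) by (auto simp: fps_quot_def mult.assoc)
qed

theorem theorem4:
  shows "let s = qvar Ind_s; t = qvar Ind_t; u = qvar Ind_u; v = qvar Ind_v;
             V = V_series (s * t) ((u + v) * qconst (1 / 2))
         in P_series s t u v = fps_quot (fps_const t * fps_deriv V) (1 - fps_const (s * t) * V)"
  unfolding Let_def
  by (rule fps_quot_eqI[symmetric, OF denominator_nth_0 P_series_mult_denominator])

end
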